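(* Let $n\ge1$, let $1\le J<2^n$, let $\mathcal{X}_p$ be the index set of $J$ punctured bits in $\mathbf{x}$ for a punctured polar code of length $M=2^n-J$, and let $\mathcal{U}_p$ be the index set of the incapable bits in $\mathbf{u}$ resulting from $\mathcal{X}_p$. Assume that $\mathcal{X}_p=\{p_0,p_1,\ldots,p_{J-1}\}$ consists of the first $J$ entries of some $2^n$-posequence $(p_0,\ldots,p_{2^n-1})$ (so that $\mathcal{X}_p$ complies with binary domination). Then $\mathcal{X}_p$ is an identical puncturing bit pattern, that is, $\mathcal{U}_p=\mathcal{X}_p$.
   Context: Let $\mathbb{Z}_{2^n}=\{0,1,\ldots,2^n-1\}$ and write $i=\sum_{t=0}^{n-1}i_t2^t$ with $i_t\in\{0,1\}$. Binary domination: $i\preceq j$ iff $i_t\le j_t$ for all $t$; $i\prec j$ iff $i\preceq j$ and $i\ne j$. A $2^n$-posequence is a permutation $(p_0,\ldots,p_{2^n-1})$ of $\mathbb{Z}_{2^n}$ such that there is no pair $i<j$ with $p_j\prec p_i$. A set $\mathcal{A}\subseteq\mathbb{Z}_{2^n}$ complies with binary domination if either $\{k:k\preceq j\}\subseteq\mathcal{A}$ for all $j\in\mathcal{A}$, or $\{k:k\succeq j\}\subseteq\mathcal{A}$ for all $j\in\mathcal{A}$. Puncturing model. The polar code of length $2^n$ encodes $\mathbf{u}\in\mathbb{F}_2^{2^n}$ to $\mathbf{x}=\mathbf{u}\left[\begin{smallmatrix}1&0\\1&1\end{smallmatrix}\right]^{\otimes n}$. A puncturing bit pattern is a set $\mathcal{X}_p\subseteq\mathbb{Z}_{2^n}$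 of indices of encoder output bits that are not transmitted. Successive-cancellation (SC) decoding computes LLRs $\alpha_i^{(t)}$ for $i\in\mathbb{Z}_{2^n}$ and stages $t=n,n-1,\ldots,0$, whose zero pattern is governed by: $\alpha_i^{(n)}=0$ iff $i\in\mathcal{X}_p$; for $t<n$ and $i_t=0$, $\alpha_i^{(t)}=0$ iff at least one of $\alpha_i^{(t+1)},\alpha_{i+2^t}^{(t+1)}$ is zero; for $t<n$ and $i_t=1$, $\alpha_i^{(t)}=0$ iff both $\alpha_{i-2^t}^{(t+1)}$ and $\alpha_i^{(t+1)}$ are zero. The bit $u_j$ is incapable if $\alpha_j^{(0)}=0$, and $\mathcal{U}_p=\{j:\alpha_j^{(0)}=0\}$. *)

theory Defs
  imports Main
begin

text \<open>
  The index set \<open>{0, \<dots>, 2 ^ n - 1}\<close> is rendered as \<open>{..<2 ^ n}\<close>, and the binary digit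
  \<open>i\<^sub>t\<close> of an index \<open>i\<close> is \<open>bit i t\<close>.
\<close>

definition dominated :: "nat \<Rightarrow> nat \<Rightarrow> nat \<Rightarrow> bool" where
  "dominated n i j \<longleftrightarrow> (\<forall>t<n. bit i t \<longrightarrow> bit j t)"

definition strictly_dominated :: "nat \<Rightarrow> nat \<Rightarrow> nat \<Rightarrow> bool" where
  "strictly_dominated n i j \<longleftrightarrow> dominated n i j \<and> i \<noteq> j"

text \<open>A sequence of length \<open>2 ^ n\<close> is a function of which only the values on \<open>{..<2 ^ n}\<close> matter.\<close>

definition posequence :: "nat \<Rightarrow> (nat \<Rightarrow> nat) \<Rightarrow> bool" where
  "posequence n p \<longleftrightarrow>
     bij_betw p {..<2 ^ n} {..<2 ^ n} \<and>
     \<not> (\<exists>i j. i < j \<and> j < 2 ^ n \<and> strictly_dominated n (p j) (p i))"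

definition complies_with_domination :: "nat \<Rightarrow> nat set \<Rightarrow> bool" where
  "complies_with_domination n A \<longleftrightarrow>
     A \<subseteq> {..<2 ^ n} \<and>
     ((\<forall>j\<in>A. {k \<in> {..<2 ^ n}. dominated n k j} \<subseteq> A) \<or>
      (\<forall>j\<in>A. {k \<in> {..<2 ^ n}. dominated n j k} \<subseteq> A))"

definition puncturing_pattern :: "nat \<Rightarrow> nat \<Rightarrow> nat set \<Rightarrow> bool" where
  "puncturing_pattern n J X \<longleftrightarrow> X \<subseteq> {..<2 ^ n} \<and> card X = J"

text \<open>
  \<open>llr_zero n X t i\<close> states that the LLR \<open>\<alpha>\<close> with index \<open>i\<close> at stage \<open>t\<close> vanishes when exactly
  the code bits with index in \<open>X\<close> are punctured.  Only stages \<open>t \<le> n\<close> and indices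
  \<open>i < 2 ^ n\<close> are meaningful; the test \<open>n \<le> t\<close> stands for the initial stage \<open>t = n\<close>.
\<close>

function llr_zero :: "nat \<Rightarrow> nat set \<Rightarrow> nat \<Rightarrow> nat \<Rightarrow> bool" where
  "llr_zero n X t i =
     (if n \<le> t then i \<in> X
      else if bit i t
        then llr_zero n X (t + 1) (i - 2 ^ t) \<and> llr_zero n X (t + 1) i
        else llr_zero n X (t + 1) i \<or> llr_zero n X (t + 1) (i + 2 ^ t))"
  by pat_completeness auto
termination
  by (relation "measure (\<lambda>(n, X, t, i). n - t)") auto

declare llr_zero.simps [simp del]

definition incapable_bits :: "nat \<Rightarrow> nat set \<Rightarrow> nat set" where
  "incapable_bits n X = {j \<in> {..<2 ^ n}. llr_zero n X 0 j}"

definition identical_pattern :: "nat \<Rightarrow> nat set \<Rightarrow> bool" where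
  "identical_pattern n X \<longleftrightarrow> incapable_bits n X = X"

lemma posequence_prefix_complies:
  assumes p: "posequence n p" and J: "J \<le> 2 ^ n"
  shows "complies_with_domination n (p ` {..<J})"
proof -
  have bij: "bij_betw p {..<2 ^ n} {..<2 ^ n}"
    using p by (simp add: posequence_def)
  have "k \<in> p ` {..<J}" if b: "b < J" and k: "k < 2 ^ n" "dominated n k (p b)" for b k
  proof -
    obtain a where a: "a < 2 ^ n" "k = p a"
      using bij k(1) by (auto simp: bij_betw_def)
    have "\<not> b < a"
    proof
      assume "b < a"
      moreover have "b < 2 ^ n" using b J by simp
      ultimately have "p a \<noteq> p b"
        using bij_betw_imp_inj_on[OF bij] a(1) \<open>b < a\<close> by (auto simp: inj_on_eq_iff)
      then show False
        using p a k(2) \<open>b < a\<close> by (auto simp: posequence_def strictly_dominated_def)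
    qed
    then show ?thesis using a b by auto
  qed
  moreover have "p ` {..<J} \<subseteq> {..<2 ^ n}"
    using bij J by (auto simp: bij_betw_def)
  ultimately show ?thesis
    by (auto simp: complies_with_domination_def)
qed

end

theory Submission
  imports Defs
begin

text \<open>
  In a posequence every index is preceded by all indices it dominates, so a prefix is a down-set.
  On a down-set both kinds of stage map leave the zero pattern unchanged: of two indices
  differing only in bit \<open>t\<close>, the one with bit \<open>1\<close> lies in the set only if the other does.
\<close>

lemma posequence_prefix_down_closed:
  assumes p: "posequence n p" and "J \<le> 2 ^ n"
    and "j \<in> p ` {..<J}" "k < 2 ^ n" "dominated n k j"
  shows "k \<in> p ` {..<J}"
proof -
  obtain b where b: "b < J" "j = p b"
    using assms(3) by auto
  obtain a where a: "a < 2 ^ n" "k = p a"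
    using p \<open>k < 2 ^ n\<close> unfolding posequence_def bij_betw_def by (metis imageE lessThan_iff)
  \<comment> \<open>If \<open>k\<close> came after \<open>j\<close>, the posequence condition would
    forbid strict domination, leaving only equality.\<close>
  have "k = j" if "b < a"
    using p a b that assms(5) by (auto simp: posequence_def strictly_dominated_def)
  then show ?thesis
    using a b by (cases "b < a") auto
qed

text \<open>Setting a bit below position \<open>n\<close> keeps a number fixed by
  \<open>take_bit n\<close>. This keeps the partner index \<open>i + 2 ^ t\<close> in range.\<close>

lemma set_bit_nat_less_exp:
  fixes i :: nat
  assumes "i < 2 ^ n" "t < n"
  shows "set_bit t i < 2 ^ n"
  using assms by (simp flip: take_bit_nat_eq_self_iff add: take_bit_set_bit_eq)

lemma llr_zero_iff_mem_of_down_closed: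
  assumes down: "\<And>j k. \<lbrakk>j \<in> X; k < 2 ^ n; dominated n k j\<rbrakk> \<Longrightarrow> k \<in> X"
    and "t \<le> n" "i < 2 ^ n"
  shows "llr_zero n X t i \<longleftrightarrow> i \<in> X"
  using assms(2,3)
\<comment> \<open>Induction follows the decoder from stage \<open>n\<close> down; \<open>i\<close>
  varies because each stage also consults the partner index.\<close>
proof (induction t arbitrary: i rule: inc_induct)
  case base
  then show ?case by (simp add: llr_zero.simps)
next
  case (step t)
  show ?case
  proof (cases "bit i t")
    case True
    \<comment> \<open>This writes \<open>i\<close> as \<open>unset_bit t i + 2 ^ t\<close>, so the
      natural subtraction below is exact.\<close>
    then have "set_bit t (unset_bit t i) = i"
      by (intro bit_eqI) (auto simp: bit_set_bit_iff bit_unset_bit_iff)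
    then have eq: "i - 2 ^ t = unset_bit t i"
      by (simp add: set_bit_eq bit_unset_bit_iff)
    have "i - 2 ^ t < 2 ^ n"
      using step.prems by simp
    moreover have "dominated n (i - 2 ^ t) i"
      by (auto simp: eq dominated_def bit_unset_bit_iff)
    ultimately show ?thesis
      using step True down by (subst llr_zero.simps) auto
  next
    case False
    then have eq: "i + 2 ^ t = set_bit t i"
      by (simp add: set_bit_eq)
    have "i + 2 ^ t < 2 ^ n"
      using step set_bit_nat_less_exp by (simp add: eq)
    moreover have "dominated n i (i + 2 ^ t)"
      by (auto simp: eq dominated_def bit_set_bit_iff)
    \<comment> \<open>By induction the disjunction is membership of \<open>i\<close> or of
      \<open>i + 2 ^ t\<close>; the latter implies the former.\<close>
    ultimately show ?thesis
      using step False down by (subst llr_zero.simps) auto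
  qed
qed

theorem theorem15:
  fixes n J M :: nat and p :: "nat \<Rightarrow> nat" and X\<^sub>p U\<^sub>p :: "nat set"
  assumes "n \<ge> 1" and "1 \<le> J" and "J < 2 ^ n" and "M = 2 ^ n - J"
    and "puncturing_pattern n J X\<^sub>p"
    and "U\<^sub>p = incapable_bits n X\<^sub>p"
    and "posequence n p" and "X\<^sub>p = p ` {..<J}"
  shows "identical_pattern n X\<^sub>p \<and> U\<^sub>p = X\<^sub>p"
proof -
  have "llr_zero n X\<^sub>p 0 i \<longleftrightarrow> i \<in> X\<^sub>p" if "i < 2 ^ n" for i
  proof (rule llr_zero_iff_mem_of_down_closed)
    show "k \<in> X\<^sub>p" if "j \<in> X\<^sub>p" "k < 2 ^ n" "dominated n k j" for j k
      using posequence_prefix_down_closed[OF assms(7)] assms(3,8) that by simp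
  qed (use that in simp_all)
  \<comment> \<open>Stage 0 was compared only on indices below \<open>2 ^ n\<close>;
    \<open>puncturing_pattern\<close> puts \<open>X\<^sub>p\<close> in that range.\<close>
  then have "incapable_bits n X\<^sub>p = X\<^sub>p"
    using assms(5) by (auto simp: incapable_bits_def puncturing_pattern_def)
  then show ?thesis
    using assms(6) by (simp add: identical_pattern_def)
qed

end
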